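(* As $n\to\infty$, $$n+\frac{\ln n}{\ln 3}-O(\ln\ln n)\;\leq\;\operatorname{ex}_{\mathbb{R}}(n)\;\leq\; n+\frac{2n}{\ln n}+O\!\left(\frac{n}{(\ln n)^2}\right).$$
   Context: Graphs are finite and simple. For a graph $G=(V,E)$ and a total order $\prec$ on $E$, we say that $\prec$ is realizable in $\mathbb{R}$ if there is an injection $p\colon V\to\mathbb{R}$ such that the edge lengths $|p(u)-p(v)|$, $uv\in E$, are pairwise distinct and, for all distinct edges $uv,xy\in E$, $uv\prec xy$ if and only if $|p(u)-p(v)|<|p(x)-p(y)|$. The quantity $\operatorname{ex}_{\mathbb{R}}(n)$ is the maximum of $|E(G)|$ over all graphs $G$ on $n$ vertices such that every total order on $E(G)$ is realizable in $\mathbb{R}$. *)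

theory Defs
  imports "HOL-Library.Landau_Symbols"
begin

definition simple_graph :: "'v set \<Rightarrow> 'v set set \<Rightarrow> bool" where
  "simple_graph V E \<longleftrightarrow>
     finite V \<and> (\<forall>e\<in>E. \<exists>u v. u \<in> V \<and> v \<in> V \<and> u \<noteq> v \<and> e = {u, v})"

definition total_edge_order :: "'e set \<Rightarrow> ('e \<times> 'e) set \<Rightarrow> bool" where
  "total_edge_order E r \<longleftrightarrow> r \<subseteq> E \<times> E \<and> strict_linear_order_on E r"

definition realizable :: "'v set \<Rightarrow> 'v set set \<Rightarrow> ('v set \<times> 'v set) set \<Rightarrow> bool" where
  "realizable V E r \<longleftrightarrow>
     (\<exists>p :: 'v \<Rightarrow> real. inj_on p V \<and>
        (\<forall>u v x y. {u, v} \<in> E \<longrightarrow> {x, y} \<in> E \<longrightarrow> {u, v} \<noteq> {x, y} \<longrightarrow>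
            \<bar>p u - p v\<bar> \<noteq> \<bar>p x - p y\<bar> \<and>
            (({u, v}, {x, y}) \<in> r \<longleftrightarrow> \<bar>p u - p v\<bar> < \<bar>p x - p y\<bar>)))"

definition all_orders_realizable :: "'v set \<Rightarrow> 'v set set \<Rightarrow> bool" where
  "all_orders_realizable V E \<longleftrightarrow> (\<forall>r. total_edge_order E r \<longrightarrow> realizable V E r)"

text \<open>Vertices are labelled by natural numbers; every finite graph has an isomorphic copy of
  this kind, and realizability is invariant under isomorphism.\<close>

definition ex_candidates :: "nat \<Rightarrow> nat set" where
  "ex_candidates n =
     {card E | (V :: nat set) E. simple_graph V E \<and> card V = n \<and> all_orders_realizable V E}"

definition ex_R :: "nat \<Rightarrow> nat" where
  "ex_R n = Max (ex_candidates n)"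

text \<open>The maximum is taken over a finite nonempty set, so it is attained.\<close>

lemma finite_ex_candidates: "finite (ex_candidates n)"
proof -
  have "k \<le> 2 ^ n" if "k \<in> ex_candidates n" for k
  proof -
    obtain V :: "nat set" and E where
      *: "k = card E" "simple_graph V E" "card V = n"
      using \<open>k \<in> ex_candidates n\<close> unfolding ex_candidates_def by blast
    then have "E \<subseteq> Pow V" "finite V"
      unfolding simple_graph_def by auto
    then have "card E \<le> card (Pow V)"
      by (intro card_mono) auto
    then show ?thesis
      using * \<open>finite V\<close> by (simp add: card_Pow)
  qed
  then show ?thesis
    by (meson finite_nat_set_iff_bounded_le)
qed

lemma ex_candidates_nonempty: "ex_candidates n \<noteq> {}"
proof -
  have "simple_graph {..<n} {}" "all_orders_realizable {..<n} {}"
    unfolding simple_graph_def all_orders_realizable_def realizable_def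
    by (auto intro!: exI[of _ real] simp: inj_on_def)
  then have "card ({} :: nat set set) \<in> ex_candidates n"
    unfolding ex_candidates_def using card_lessThan by blast
  then show ?thesis by blast
qed

end

theory Submission
  imports Defs "HOL-Combinatorics.Permutations" "HOL-Real_Asymp.Real_Asymp"
begin

text \<open>
  Upper bound. Orient the edges and write the oriented lengths as linear forms in the positions of
  the vertices. Whether one edge is shorter than another depends only on the signs of the difference
  and of the sum of their two forms, so the order that is realized by a placement of \<open>n\<close> vertices is
  determined by the signs of at most \<open>m\<^sup>2\<close> linear forms in \<open>n\<close> variables, where \<open>m\<close> is the number of
  edges. The sets of forms that are positive at some point shatter no set of more than \<open>n\<close> forms, so
  by the Sauer-Shelah lemma there are at most \<open>\<Sum>i\<le>n. m\<^sup>2 choose i\<close> of them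
  (\<open>card_sign_patterns_le\<close>). If all \<open>m!\<close> orders are realizable then this number is at least \<open>m!\<close>
  (\<open>fact_le_sum_binomial\<close>); taking logarithms yields \<open>m \<le> n + 2 * n / (ln n - 2)\<close>, and
  \<open>2 * n / (ln n - 2)\<close> exceeds \<open>2 * n / ln n\<close> by \<open>O(n / (ln n)\<^sup>2)\<close>.

  Lower bound. Let \<open>k\<close> cycles of almost equal length share one vertex, which gives \<open>n\<close> vertices
  and \<open>m = n + k - 1\<close> edges. A choice of edge lengths is realized by a map from the vertices to the
  line as soon as in each cycle the lengths, with suitable signs, add up to zero; this map can then be
  made injective by a small perturbation. Given an order of the edges, take the rank of an edge as a
  first approximation of its length. The ranks in a cycle form a set of about \<open>n / k\<close> numbers up
  to \<open>m\<close>, and when \<open>n\<close> is large compared with \<open>k\<close> such a set can be signed so that its signed sum is at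
  most a quarter of its size (\<open>small_signing\<close>). Changing every length of the cycle by at most \<open>1/4\<close>
  then makes the sum vanish, and the order of the lengths remains that of the ranks, because ranks of
  different edges differ by at least 1. The cycles have disjoint edge sets, so the corrections do
  not interfere. All this works when \<open>200 * k ^ 4 \<le> n\<close> (\<open>ex_R_ge\<close>), so \<open>n + k - 1\<close> edges are possible
  even for \<open>k\<close> of order \<open>n\<close> to the power \<open>1/4\<close>. The asserted bound follows with \<open>k\<close> about \<open>ln n + 1\<close>,
  since \<open>ln 3 \<ge> 1\<close>; the error term of the lower bound can be taken to be zero.
\<close>

section \<open>Shattering and the number of sign patterns\<close>

definition shatters :: "'a set set \<Rightarrow> 'a set \<Rightarrow> bool" where
  "shatters F S \<longleftrightarrow> (\<forall>T\<subseteq>S. \<exists>A\<in>F. A \<inter> S = T)"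

text \<open>Pajor's form of the Sauer-Shelah lemma. Split \<open>F\<close> by membership of \<open>x\<close> into \<open>F0\<close> and \<open>F1\<close>. A set
  shattered by one of the halves is shattered by \<open>F\<close>, and if \<open>S\<close> is shattered by both halves then
  \<open>insert x S\<close> is shattered by \<open>F\<close> as well. So sets that the induction counts twice also account for
  two shattered sets.\<close>

lemma card_le_card_shattered:
  assumes "finite X" "F \<subseteq> Pow X"
  shows "card F \<le> card {S. S \<subseteq> X \<and> shatters F S}"
  using assms
proof (induction X arbitrary: F rule: finite_induct)
  case empty
  show ?case
  proof (cases "F = {}")
    case False
    then have "F = {{}}" using empty by auto
    then have "{S. S \<subseteq> {} \<and> shatters F S} = {{}}" by (auto simp: shatters_def)
    then show ?thesis using \<open>F = {{}}\<close> by simp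
  qed simp
next
  case (insert x X)
  define F0 where "F0 = {A\<in>F. x \<notin> A}"
  define F1 where "F1 = (\<lambda>A. A - {x}) ` {A\<in>F. x \<in> A}"
  define sh where "sh G = {S. S \<subseteq> X \<and> shatters G S}" for G
  have finF: "finite F" using insert by (meson finite.insertI finite_Pow_iff finite_subset)
  have fin: "finite (sh G)" for G unfolding sh_def using insert by auto
  have sub: "F0 \<subseteq> Pow X" "F1 \<subseteq> Pow X" using insert by (auto simp: F0_def F1_def)
  have "inj_on (\<lambda>A. A - {x}) {A\<in>F. x \<in> A}" by (rule inj_onI) auto
  then have "card F1 = card {A\<in>F. x \<in> A}" unfolding F1_def by (rule card_image)
  moreover have "card F = card F0 + card {A\<in>F. x \<in> A}"
    unfolding F0_def using finF by (subst card_Un_disjoint[symmetric]) (auto intro: arg_cong[of _ _ card])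
  ultimately have cF: "card F = card F0 + card F1" by simp
  have F0: "\<exists>A\<in>F. x \<notin> A \<and> A \<inter> S = T" if "S \<in> sh F0" "T \<subseteq> S" for S T
    using that unfolding sh_def shatters_def F0_def by blast
  have F1: "\<exists>A\<in>F. x \<in> A \<and> A \<inter> S = T" if "S \<in> sh F1" "T \<subseteq> S" for S T
  proof -
    have "\<exists>B\<in>F1. B \<inter> S = T" using that by (simp add: sh_def shatters_def)
    then obtain A where "A \<in> F" "x \<in> A" "(A - {x}) \<inter> S = T" unfolding F1_def by blast
    moreover have "x \<notin> S" using that insert.hyps by (auto simp: sh_def)
    ultimately show ?thesis by blast
  qed
  have s0: "shatters F S" if "S \<in> sh F0" for S
    unfolding shatters_def using F0[OF that] by blast
  have s1: "shatters F S" if "S \<in> sh F1" for S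
    unfolding shatters_def using F1[OF that] by blast
  have s01: "shatters F (insert x S)" if S: "S \<in> sh F0" "S \<in> sh F1" for S
    unfolding shatters_def
  proof (intro allI impI)
    fix T assume T: "T \<subseteq> insert x S"
    show "\<exists>A\<in>F. A \<inter> insert x S = T"
    proof (cases "x \<in> T")
      case True
      have "T - {x} \<subseteq> S" using T by auto
      then obtain A where "A \<in> F" "x \<in> A" "A \<inter> S = T - {x}" using F1[OF S(2)] by blast
      then have "A \<inter> insert x S = T" using True by auto
      then show ?thesis using \<open>A \<in> F\<close> by blast
    next
      case False
      then have "T \<subseteq> S" using T by auto
      then obtain A where "A \<in> F" "x \<notin> A" "A \<inter> S = T" using F0[OF S(1)] by blast
      then have "A \<inter> insert x S = T" by auto
      then show ?thesis using \<open>A \<in> F\<close> by blast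
    qed
  qed
  have "card F \<le> card (sh F0) + card (sh F1)"
    unfolding cF sh_def using insert.IH[OF sub(1)] insert.IH[OF sub(2)] by linarith
  also have "\<dots> = card (sh F0 \<union> sh F1) + card (sh F0 \<inter> sh F1)"
    using fin by (intro card_Un_Int) auto
  also have "card (sh F0 \<inter> sh F1) = card (insert x ` (sh F0 \<inter> sh F1))"
  proof (rule card_image[symmetric], rule inj_onI)
    fix S T assume "S \<in> sh F0 \<inter> sh F1" "T \<in> sh F0 \<inter> sh F1" "insert x S = insert x T"
    then show "S = T" using insert.hyps unfolding sh_def by (metis (no_types, lifting) IntD1 insert_ident mem_Collect_eq subsetD)
  qed
  also have "card (sh F0 \<union> sh F1) + card (insert x ` (sh F0 \<inter> sh F1)) =
      card ((sh F0 \<union> sh F1) \<union> insert x ` (sh F0 \<inter> sh F1))"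
    using fin insert by (intro card_Un_disjoint[symmetric]) (auto simp: sh_def)
  also have "\<dots> \<le> card {S. S \<subseteq> insert x X \<and> shatters F S}"
    using s0 s1 s01 insert by (intro card_mono) (auto simp: sh_def)
  finally show ?case .
qed

lemma card_le_sum_binomial:
  assumes "finite X" "F \<subseteq> Pow X" "\<And>S. S \<subseteq> X \<Longrightarrow> shatters F S \<Longrightarrow> card S \<le> d"
  shows "card F \<le> (\<Sum>i\<le>d. card X choose i)"
proof -
  have "card F \<le> card {S. S \<subseteq> X \<and> shatters F S}"
    by (rule card_le_card_shattered[OF assms(1,2)])
  also have "\<dots> \<le> card (\<Union>i\<le>d. {S. S \<subseteq> X \<and> card S = i})"
    using assms by (intro card_mono) auto
  also have "\<dots> \<le> (\<Sum>i\<le>d. card {S. S \<subseteq> X \<and> card S = i})"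
    by (rule card_UN_le) simp
  also have "\<dots> = (\<Sum>i\<le>d. card X choose i)"
    using assms(1) by (simp add: n_subsets)
  finally show ?thesis .
qed

lemma linear_dependence:
  fixes a :: "'i \<Rightarrow> 'v \<Rightarrow> real"
  assumes "finite V" "finite S" "card V < card S"
  shows "\<exists>c. (\<exists>i\<in>S. c i \<noteq> 0) \<and> (\<forall>v\<in>V. (\<Sum>i\<in>S. c i * a i v) = 0)"
  using assms
proof (induction V arbitrary: S a rule: finite_induct)
  case empty
  then have "S \<noteq> {}" by auto
  then show ?case by (intro exI[of _ "\<lambda>_. 1"]) auto
next
  case (insert v V)
  show ?case
  proof (cases "\<forall>i\<in>S. a i v = 0")
    case True
    have "card V < card S" using insert by simp
    then obtain c where "\<exists>i\<in>S. c i \<noteq> 0" "\<forall>v\<in>V. (\<Sum>i\<in>S. c i * a i v) = 0"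
      using insert.IH[OF insert.prems(1), of a] by blast
    then show ?thesis using True by (intro exI[of _ c]) auto
  next
    case False
    then obtain j where j: "j \<in> S" "a j v \<noteq> 0" by auto
    \<comment> \<open>Gaussian elimination: the row of \<open>j\<close> clears coordinate \<open>v\<close> in all the other rows.\<close>
    define b where "b i u = a i u - a i v / a j v * a j u" for i u
    have "card V < card (S - {j})" using insert j by auto
    then obtain c where c: "\<exists>i\<in>S - {j}. c i \<noteq> 0" "\<forall>u\<in>V. (\<Sum>i\<in>S - {j}. c i * b i u) = 0"
      using insert.IH[of "S - {j}" b] insert.prems(1) by blast
    define t where "t = - (\<Sum>i\<in>S - {j}. c i * a i v) / a j v"
    have exp: "(\<Sum>i\<in>S. (c(j := t)) i * a i u) = t * a j u + (\<Sum>i\<in>S - {j}. c i * a i u)" for u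
      using j insert by (subst sum.remove[of S j]) (auto intro!: sum.cong)
    have "t * a j u = - (\<Sum>i\<in>S - {j}. c i * a i u)" if "u \<in> V" for u
    proof -
      have "0 = (\<Sum>i\<in>S - {j}. c i * a i u) - (\<Sum>i\<in>S - {j}. c i * a i v) / a j v * a j u"
        using c(2) that
        by (simp add: b_def algebra_simps sum_subtractf sum_distrib_left sum_distrib_right sum_divide_distrib)
      then show ?thesis by (simp add: t_def)
    qed
    moreover have "t * a j v = - (\<Sum>i\<in>S - {j}. c i * a i v)" using j by (simp add: t_def)
    ultimately show ?thesis using c(1) exp by (intro exI[of _ "c(j := t)"]) auto
  qed
qed

text \<open>More than \<open>card V\<close> of the forms satisfy a nontrivial linear relation. No point makes exactly
  those of them positive that have a positive coefficient in the relation, because there all terms of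
  the relation would be nonnegative and one of them positive. So such a set is not shattered.\<close>

lemma card_sign_patterns_le:
  fixes a :: "'i \<Rightarrow> 'v \<Rightarrow> real"
  assumes "finite X" "finite V"
  shows "card (range (\<lambda>x. {i\<in>X. (\<Sum>v\<in>V. a i v * x v) > 0})) \<le> (\<Sum>i\<le>card V. card X choose i)"
    (is "card ?F \<le> _")
proof (rule card_le_sum_binomial)
  fix S assume S: "S \<subseteq> X" "shatters ?F S"
  show "card S \<le> card V"
  proof (rule ccontr)
    assume "\<not> card S \<le> card V"
    moreover have "finite S" using S assms finite_subset by auto
    ultimately obtain c0 where c0: "\<exists>i\<in>S. c0 i \<noteq> 0" "\<forall>v\<in>V. (\<Sum>i\<in>S. c0 i * a i v) = 0"
      using linear_dependence[of V S a] assms by auto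
    \<comment> \<open>If no coefficient is positive, the negated relation has one; this makes the sum below
      strictly positive.\<close>
    obtain c where c: "\<exists>i\<in>S. c i > 0" "\<forall>v\<in>V. (\<Sum>i\<in>S. c i * a i v) = 0"
    proof (cases "\<exists>i\<in>S. c0 i > 0")
      case False
      with c0 show ?thesis
        by (intro that[of "\<lambda>i. - c0 i"]) (auto simp: sum_negf neq_iff)
    qed (use c0 that in blast)
    have "{i\<in>S. c i > 0} \<subseteq> S" by auto
    then obtain x where x: "{i\<in>X. (\<Sum>v\<in>V. a i v * x v) > 0} \<inter> S = {i\<in>S. c i > 0}"
      using S(2) unfolding shatters_def by blast
    have iff: "(\<Sum>v\<in>V. a i v * x v) > 0 \<longleftrightarrow> c i > 0" if "i \<in> S" for i
      using x S(1) that by blast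
    have "(\<Sum>i\<in>S. c i * (\<Sum>v\<in>V. a i v * x v)) = (\<Sum>v\<in>V. (\<Sum>i\<in>S. c i * a i v) * x v)"
      unfolding sum_distrib_left sum_distrib_right by (subst sum.swap) (simp add: mult_ac)
    also have "\<dots> = 0" using c(2) by simp
    finally have zero: "(\<Sum>i\<in>S. c i * (\<Sum>v\<in>V. a i v * x v)) = 0" .
    obtain j where j: "j \<in> S" "c j > 0" using c by auto
    have "(\<Sum>i\<in>S. c i * (\<Sum>v\<in>V. a i v * x v)) > 0"
    proof (rule sum_pos2[OF _ j(1)])
      show "finite S" using S assms finite_subset by auto
      show "0 < c j * (\<Sum>v\<in>V. a j v * x v)" using j iff by auto
      show "0 \<le> c i * (\<Sum>v\<in>V. a i v * x v)" if "i \<in> S" for i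
        using iff[OF that] by (cases "c i > 0") (auto intro: mult_nonpos_nonpos)
    qed
    with zero show False by simp
  qed
qed (use assms in auto)

section \<open>The upper bound\<close>

text \<open>Every permutation of the edges gives an order; choose a placement that realizes it. Its sign
  pattern for the differences and sums of two oriented lengths gives back the permutation.\<close>

lemma fact_le_sum_binomial:
  fixes V :: "'v set"
  assumes "simple_graph V E" "all_orders_realizable V E"
  shows "fact (card E) \<le> (\<Sum>i\<le>card V. (card E)\<^sup>2 choose i)"
proof -
  define m where "m = card E"
  have fV: "finite V" using assms unfolding simple_graph_def by auto
  have "E \<subseteq> Pow V" using assms unfolding simple_graph_def by auto
  then have fE: "finite E" using fV finite_subset by auto
  obtain \<phi> where \<phi>: "bij_betw \<phi> {..<m} E"
    using ex_bij_betw_nat_finite[OF fE] unfolding m_def atLeast0LessThan by blast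
  have "\<forall>i. \<exists>u v. i < m \<longrightarrow> u \<in> V \<and> v \<in> V \<and> \<phi> i = {u, v}"
    using \<phi> assms(1) unfolding simple_graph_def bij_betw_def by blast
  then obtain a b where ab: "\<And>i. i < m \<Longrightarrow> a i \<in> V \<and> b i \<in> V \<and> \<phi> i = {a i, b i}"
    by metis
  have \<phi>E: "\<phi> i \<in> E" if "i < m" for i using \<phi> that by (auto simp: bij_betw_def)
  have \<phi>inj: "\<phi> i = \<phi> j \<longleftrightarrow> i = j" if "i < m" "j < m" for i j
    using \<phi> that by (auto simp: bij_betw_def inj_on_def)
  define d where "d i v = (of_bool (v = a i) - of_bool (v = b i) :: real)" for i v
  define len where "len p i = p (a i) - p (b i)" for p :: "'v \<Rightarrow> real" and i
  \<comment> \<open>For \<open>i < j\<close> the pair \<open>(i, j)\<close> carries the difference of the two oriented lengths and \<open>(j, i)\<close>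
    their sum.\<close>
  define coef where "coef = (\<lambda>(i, j) v. if i < j then d i v - d j v else d i v + d j v)"
  define pat where
    "pat p = {ij \<in> {..<m} \<times> {..<m}. (\<Sum>v\<in>V. coef ij v * p v) > 0}" for p :: "'v \<Rightarrow> real"
  have len: "(\<Sum>v\<in>V. d i v * p v) = len p i" if "i < m" for i p
    using ab[OF that] fV
    by (simp add: d_def len_def left_diff_distrib sum_subtractf of_bool_def if_distrib[of "\<lambda>x. x * _"] cong: if_cong)
  have pat: "(i, j) \<in> pat p \<longleftrightarrow> (if i < j then len p i - len p j else len p i + len p j) > 0"
    if "i < m" "j < m" for i j p
    using that len[of i p] len[of j p]
    by (simp add: pat_def coef_def left_diff_distrib distrib_right sum_subtractf sum.distrib)
  have fpat: "card (range pat) \<le> (\<Sum>i\<le>card V. m\<^sup>2 choose i)"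
    using card_sign_patterns_le[of "{..<m} \<times> {..<m}" V coef] fV
    unfolding pat_def by (simp add: card_cartesian_product power2_eq_square)
  \<comment> \<open>The difference of the squares is the product of the two forms, so it is negative iff their
    signs differ.\<close>
  have less: "\<bar>len p i\<bar> < \<bar>len p j\<bar> \<longleftrightarrow> ((i, j) \<in> pat p) \<noteq> ((j, i) \<in> pat p)"
    if "i < j" "j < m" "\<bar>len p i\<bar> \<noteq> \<bar>len p j\<bar>" for i j p
    using that by (simp add: pat) linarith
  have "\<exists>p. \<forall>i<m. \<forall>j<m. i \<noteq> j \<longrightarrow>
          \<bar>len p i\<bar> \<noteq> \<bar>len p j\<bar> \<and> (\<pi> i < \<pi> j \<longleftrightarrow> \<bar>len p i\<bar> < \<bar>len p j\<bar>)"
    if \<pi>: "\<pi> permutes {..<m}" for \<pi> :: "nat \<Rightarrow> nat"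
  proof -
    define r where "r = {(\<phi> i, \<phi> j) | i j. i < m \<and> j < m \<and> \<pi> i < \<pi> j}"
    have r: "(\<phi> i, \<phi> j) \<in> r \<longleftrightarrow> \<pi> i < \<pi> j" if "i < m" "j < m" for i j
      using that \<phi>inj unfolding r_def by auto
    have "total_edge_order E r"
      unfolding total_edge_order_def strict_linear_order_on_def
    proof (intro conjI)
      show "r \<subseteq> E \<times> E" using \<phi>E by (auto simp: r_def)
      show "trans r"
      proof (rule transI)
        fix x y z assume "(x, y) \<in> r" "(y, z) \<in> r"
        then obtain i j j' l where "x = \<phi> i" "y = \<phi> j" "y = \<phi> j'" "z = \<phi> l" "i < m" "j < m" "j' < m" "l < m"
          "\<pi> i < \<pi> j" "\<pi> j' < \<pi> l" unfolding r_def by blast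
        then show "(x, z) \<in> r" using \<phi>inj r by auto
      qed
      show "irrefl r"
        using \<phi>inj by (auto simp: irrefl_def r_def)
      show "total_on E r"
      proof (rule total_onI)
        fix e f assume "e \<in> E" "f \<in> E" "e \<noteq> f"
        then obtain i j where ij: "e = \<phi> i" "f = \<phi> j" "i < m" "j < m" "i \<noteq> j"
          using \<phi> unfolding bij_betw_def by auto
        then have "\<pi> i \<noteq> \<pi> j" using permutes_inj[OF \<pi>] by (auto dest: injD)
        then show "(e, f) \<in> r \<or> (f, e) \<in> r" using ij r by auto
      qed
    qed
    then obtain p :: "'v \<Rightarrow> real" where
      p: "\<And>u v x y. \<lbrakk>{u, v} \<in> E; {x, y} \<in> E; {u, v} \<noteq> {x, y}\<rbrakk> \<Longrightarrow>
            \<bar>p u - p v\<bar> \<noteq> \<bar>p x - p y\<bar> \<and>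
            (({u, v}, {x, y}) \<in> r \<longleftrightarrow> \<bar>p u - p v\<bar> < \<bar>p x - p y\<bar>)"
      using assms(2) unfolding all_orders_realizable_def realizable_def by blast
    have "\<bar>len p i\<bar> \<noteq> \<bar>len p j\<bar> \<and> (\<pi> i < \<pi> j \<longleftrightarrow> \<bar>len p i\<bar> < \<bar>len p j\<bar>)"
      if "i < m" "j < m" "i \<noteq> j" for i j
      using p[of "a i" "b i" "a j" "b j"] that ab \<phi>E \<phi>inj r unfolding len_def by metis
    then show ?thesis by blast
  qed
  then obtain P where P: "\<And>\<pi> i j. \<lbrakk>\<pi> permutes {..<m}; i < m; j < m; i \<noteq> j\<rbrakk> \<Longrightarrow>
          \<bar>len (P \<pi>) i\<bar> \<noteq> \<bar>len (P \<pi>) j\<bar> \<and> (\<pi> i < \<pi> j \<longleftrightarrow> \<bar>len (P \<pi>) i\<bar> < \<bar>len (P \<pi>) j\<bar>)"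
    by metis
  have "inj_on (\<lambda>\<pi>. pat (P \<pi>)) {\<pi>. \<pi> permutes {..<m}}"
  proof (rule inj_onI, clarify)
    fix \<pi> \<sigma> assume \<pi>: "\<pi> permutes {..<m}" and \<sigma>: "\<sigma> permutes {..<m}" and eq: "pat (P \<pi>) = pat (P \<sigma>)"
    have less1: "\<pi> i < \<pi> j \<longleftrightarrow> \<sigma> i < \<sigma> j" if "i < j" "j < m" for i j
      using P[OF \<pi>, of i j] P[OF \<sigma>, of i j] less[of i j "P \<pi>"] less[of i j "P \<sigma>"] that eq by auto
    have iff: "\<pi> i < \<pi> j \<longleftrightarrow> \<sigma> i < \<sigma> j" if "i < m" "j < m" for i j
    proof (cases i j rule: linorder_cases)
      case greater
      moreover have "\<pi> i \<noteq> \<pi> j" "\<sigma> i \<noteq> \<sigma> j"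
        using greater permutes_inj[OF \<pi>] permutes_inj[OF \<sigma>] by (auto dest: injD)
      ultimately show ?thesis using less1[of j i] that by linarith
    qed (use less1 that in auto)
    \<comment> \<open>A permutation is determined by the order of its values: each value counts the smaller ones.\<close>
    have count: "\<tau> i = card {j\<in>{..<m}. \<tau> j < \<tau> i}" if "\<tau> permutes {..<m}" "i < m" for \<tau> i
    proof -
      have "\<tau> ` {j\<in>{..<m}. \<tau> j < \<tau> i} = {..<\<tau> i}"
      proof -
        have "\<tau> i < m" using permutes_in_image[OF that(1)] that(2) by auto
        moreover have "\<tau> ` {..<m} = {..<m}" by (rule permutes_image[OF that(1)])
        ultimately show ?thesis by (auto simp: image_iff set_eq_iff) (metis lessThan_iff image_iff order_less_trans)
      qed
      moreover have "inj_on \<tau> {j\<in>{..<m}. \<tau> j < \<tau> i}"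
        using permutes_inj[OF that(1)] by (rule inj_on_subset) auto
      ultimately show ?thesis by (metis card_image card_lessThan)
    qed
    show "\<pi> = \<sigma>"
    proof
      fix i show "\<pi> i = \<sigma> i"
      proof (cases "i < m")
        case True
        then have "{j\<in>{..<m}. \<pi> j < \<pi> i} = {j\<in>{..<m}. \<sigma> j < \<sigma> i}" using iff by auto
        then show ?thesis using count[OF \<pi> True] count[OF \<sigma> True] by simp
      next
        case False
        then show ?thesis using permutes_not_in[OF \<pi>] permutes_not_in[OF \<sigma>] by simp
      qed
    qed
  qed
  moreover have "finite (range pat)"
    by (rule finite_subset[of _ "Pow ({..<m} \<times> {..<m})"]) (auto simp: pat_def)
  ultimately have "card {\<pi>. \<pi> permutes {..<m}} \<le> card (range pat)"
    by (intro card_inj_on_le[of "\<lambda>\<pi>. pat (P \<pi>)"]) auto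
  also have "card {\<pi>. \<pi> permutes {..<m}} = fact m"
    by (rule card_permutations) auto
  finally show ?thesis using fpat unfolding m_def by linarith
qed

lemma sum_binomial_le:
  assumes "1 \<le> n" "n \<le> N"
  shows "(\<Sum>i\<le>n. real (N choose i)) \<le> (exp 1 * real N / real n) ^ n"
proof -
  \<comment> \<open>As \<open>x \<le> 1\<close>, weighting the terms by \<open>x ^ i\<close> instead of \<open>x ^ n\<close> only increases the sum, which then
    extends to the full binomial sum.\<close>
  define x where "x = real n / real N"
  have x: "0 < x" "x \<le> 1" using assms by (auto simp: x_def)
  have "(\<Sum>i\<le>n. real (N choose i)) * x ^ n = (\<Sum>i\<le>n. real (N choose i) * x ^ n)"
    by (simp add: sum_distrib_right)
  also have "\<dots> \<le> (\<Sum>i\<le>n. real (N choose i) * x ^ i)"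
    using x by (intro sum_mono mult_left_mono power_decreasing) auto
  also have "\<dots> \<le> (\<Sum>i\<le>N. real (N choose i) * x ^ i)"
    using x assms by (intro sum_mono2) auto
  also have "\<dots> = (x + 1) ^ N"
    by (simp add: binomial_ring)
  also have "\<dots> \<le> exp x ^ N"
    using x exp_ge_add_one_self[of x] by (intro power_mono) (auto simp: add.commute)
  also have "\<dots> = exp 1 ^ n"
    using assms by (simp add: x_def flip: exp_of_nat_mult)
  finally have "(\<Sum>i\<le>n. real (N choose i)) \<le> exp 1 ^ n / x ^ n"
    using x by (simp add: field_simps)
  also have "\<dots> = (exp 1 * real N / real n) ^ n"
    by (simp add: x_def power_divide power_mult_distrib)
  finally show ?thesis .
qed

text \<open>Compare \<open>exp m\<close> with the term of index \<open>m\<close> of its power series.\<close>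

lemma ln_fact_ge: "real m * ln (real m) - real m \<le> ln (fact m)"
proof (cases "m = 0")
  case False
  have "real m ^ m / fact m = (\<Sum>i\<in>{m}. inverse (fact i) * real m ^ i)"
    by (simp add: field_simps)
  also have "\<dots> \<le> (\<Sum>i. inverse (fact i) * real m ^ i)"
    by (rule sum_le_suminf[OF summable_exp]) auto
  also have "\<dots> = exp (real m)" by (simp add: exp_def field_simps)
  finally have "real m ^ m \<le> exp (real m) * fact m" by (simp add: field_simps)
  then have "ln (real m ^ m) \<le> ln (exp (real m) * fact m)"
    using False by (subst ln_le_cancel_iff) auto
  then show ?thesis using False by (simp add: ln_mult ln_realpow)
qed simp

text \<open>With \<open>m = n * (1 + c)\<close> and \<open>l = ln (1 + c)\<close>, the logarithms of the two sides of the assumption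
  give \<open>c * ln n + (c - 1) * l \<le> 2 + c\<close>. Here \<open>(c - 1) * l \<ge> - c\<close>, trivially for \<open>c \<ge> 1\<close> and because of
  \<open>l \<le> c\<close> otherwise, so \<open>c * (ln n - 2) \<le> 2\<close>.\<close>

lemma excess_le_of_fact_le:
  assumes "1 \<le> n" "n \<le> m" "ln (real n) > 2"
    and "fact m \<le> (\<Sum>i\<le>n. m\<^sup>2 choose i)"
  shows "real m \<le> real n + 2 * real n / (ln (real n) - 2)"
proof -
  define c where "c = (real m - real n) / real n"
  have c: "c \<ge> 0" "real m = real n * (1 + c)" using assms by (auto simp: c_def field_simps)
  define l where "l = ln (1 + c)"
  have l: "0 \<le> l" "l \<le> c" using c ln_add_one_self_le_self[of c] by (auto simp: l_def)
  have lnm: "ln (real m) = ln (real n) + l"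
    using c assms by (simp add: l_def ln_mult)
  have "n \<le> m\<^sup>2" using assms(2) by (simp add: power2_eq_square order_trans[OF _ le_square])
  have "real (fact m) \<le> real (\<Sum>i\<le>n. m\<^sup>2 choose i)"
    using assms(4) by (intro of_nat_mono)
  also have "\<dots> \<le> (exp 1 * real (m\<^sup>2) / real n) ^ n"
    using sum_binomial_le[OF assms(1) \<open>n \<le> m\<^sup>2\<close>] by simp
  finally have "ln (fact m) \<le> ln ((exp 1 * real (m\<^sup>2) / real n) ^ n)"
    using assms by (subst ln_le_cancel_iff) auto
  also have "\<dots> = real n * (1 + 2 * ln (real m) - ln (real n))"
    using assms by (simp add: ln_realpow ln_div ln_mult)
  finally have "real m * ln (real m) - real m \<le> real n * (1 + 2 * ln (real m) - ln (real n))"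
    using ln_fact_ge[of m] by linarith
  then have "real n * ((1 + c) * (ln (real n) + l) - (1 + c)) \<le> real n * (1 + 2 * (ln (real n) + l) - ln (real n))"
    unfolding lnm by (simp add: c(2) algebra_simps)
  then have "(1 + c) * (ln (real n) + l) - (1 + c) \<le> 1 + 2 * (ln (real n) + l) - ln (real n)"
    using assms by (subst (asm) mult_le_cancel_left_pos) auto
  then have *: "c * ln (real n) + (c - 1) * l \<le> 2 + c" by (simp add: algebra_simps)
  have "(c - 1) * l \<ge> - c"
  proof (cases "c \<ge> 1")
    case False
    have "(1 - c) * l \<le> 1 * c" using False c l by (intro mult_mono) auto
    then show ?thesis by (simp add: algebra_simps)
  qed (use c l in \<open>auto intro: order_trans[of _ 0]\<close>)
  with * have "c * (ln (real n) - 2) \<le> 2" by (simp add: algebra_simps)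
  then have "c \<le> 2 / (ln (real n) - 2)" using assms(3) by (simp add: field_simps)
  then have "real n * c \<le> real n * (2 / (ln (real n) - 2))" by (intro mult_left_mono) auto
  then show ?thesis using c(2) by (simp add: algebra_simps)
qed

lemma ex_R_le:
  assumes "ln (real n) > 2"
  shows "real (ex_R n) \<le> real n + 2 * real n / (ln (real n) - 2)"
proof -
  have "ex_R n \<in> ex_candidates n"
    unfolding ex_R_def using finite_ex_candidates ex_candidates_nonempty by (rule Max_in)
  then obtain V :: "nat set" and E where VE: "simple_graph V E" "card V = n"
    "all_orders_realizable V E" "ex_R n = card E"
    unfolding ex_candidates_def by blast
  have n: "1 \<le> n" using assms by (cases n) auto
  show ?thesis
  proof (cases "n \<le> card E")
    case True
    show ?thesis
      unfolding VE(4) using fact_le_sum_binomial[OF VE(1,3)] VE(2)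
      by (intro excess_le_of_fact_le[OF n True assms]) simp
  next
    case False
    then show ?thesis using assms VE(4) by (simp add: add_increasing2)
  qed
qed

section \<open>Sets of integers with a small signed sum\<close>

lemma sum_lessThan_card_le:
  fixes A :: "nat set"
  assumes "finite A"
  shows "\<Sum>{..<card A} \<le> \<Sum>A"
  using assms
proof (induction A rule: finite_linorder_max_induct)
  case (insert b A)
  have "card A \<le> card {..<b}" using insert by (intro card_mono) auto
  moreover have "b \<notin> A" using insert by auto
  ultimately show ?case using insert by (simp add: lessThan_Suc)
qed simp

text \<open>Measured from the maximum \<open>c\<close> of \<open>P\<close>, the elements of \<open>P\<close> lie at distinct distances \<open>0, 1, \<dots>\<close> or
  more below, and those of \<open>N\<close> at distinct distances \<open>1, 2, \<dots>\<close> or more above.\<close>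

lemma sum_diff_ge_of_separated:
  fixes P N :: "nat set"
  assumes "finite P" "finite N" "card P = h" "card N = h" "\<And>x y. x \<in> P \<Longrightarrow> y \<in> N \<Longrightarrow> x < y"
  shows "int (\<Sum>N) - int (\<Sum>P) \<ge> (int h)\<^sup>2"
proof (cases "h = 0")
  case False
  define c where "c = Max P"
  have "P \<noteq> {}" using assms False by auto
  then have c: "c \<in> P" "\<And>x. x \<in> P \<Longrightarrow> x \<le> c" "\<And>y. y \<in> N \<Longrightarrow> Suc c \<le> y"
    using assms unfolding c_def by (auto simp: Suc_le_eq)
  have sums: "2 * int (\<Sum>{..<h}) = int h * (int h - 1)"
    by (induction h) (auto simp: algebra_simps)
  have inj: "inj_on (\<lambda>x. c - x) P"
    using c by (intro inj_onI) (metis diff_diff_cancel)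
  have "\<Sum>{..<h} \<le> \<Sum>((\<lambda>x. c - x) ` P)"
    using sum_lessThan_card_le[of "(\<lambda>x. c - x) ` P"] assms card_image[OF inj] by simp
  also have "\<dots> = (\<Sum>x\<in>P. c - x)"
    using inj by (simp add: sum.reindex)
  finally have "int (\<Sum>{..<h}) \<le> int (\<Sum>x\<in>P. c - x)" by (rule of_nat_mono)
  also have "\<dots> = (\<Sum>x\<in>P. int c - int x)"
    unfolding of_nat_sum using c by (intro sum.cong) (auto simp: of_nat_diff)
  finally have "int (\<Sum>{..<h}) \<le> (\<Sum>x\<in>P. int c - int x)" .
  then have p: "int (\<Sum>{..<h}) \<le> int h * int c - int (\<Sum>P)"
    using assms by (simp add: sum_subtractf)
  have inj: "inj_on (\<lambda>y. y - Suc c) N"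
    using c by (intro inj_on_diff_nat) auto
  have "\<Sum>{..<h} \<le> \<Sum>((\<lambda>y. y - Suc c) ` N)"
    using sum_lessThan_card_le[of "(\<lambda>y. y - Suc c) ` N"] assms inj
    by (simp add: card_image)
  also have "\<dots> = (\<Sum>y\<in>N. y - Suc c)"
    using inj by (simp add: sum.reindex)
  finally have "int (\<Sum>{..<h}) \<le> int (\<Sum>y\<in>N. y - Suc c)" by (rule of_nat_mono)
  also have "\<dots> = (\<Sum>y\<in>N. int y - int (Suc c))"
    unfolding of_nat_sum using c by (intro sum.cong refl of_nat_diff) auto
  finally have "int (\<Sum>{..<h}) \<le> (\<Sum>y\<in>N. int y - int (Suc c))" .
  then have "int (\<Sum>{..<h}) \<le> int (\<Sum>N) - int h * (int c + 1)"
    using assms by (simp add: sum_subtractf algebra_simps sum.distrib)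
  then show ?thesis using p sums by (simp add: algebra_simps power2_eq_square)
qed (use assms in auto)

text \<open>The elements of \<open>P\<close> get the sign plus, those of \<open>H - P\<close> minus. If every element of \<open>P\<close> were below
  every element of \<open>H - P\<close>, the contribution of \<open>H\<close> would be at most \<open>- h\<^sup>2\<close> and the total not positive.
  So some \<open>x\<close> with sign minus is below some \<open>y\<close> with sign plus. Exchanging their signs lowers the total by
  \<open>2 * (y - x)\<close>, which is positive and at most \<open>2 * D\<close>, hence less than twice the total: the absolute
  value decreases.\<close>

lemma balanced_signing_step:
  fixes H :: "nat set" and R D :: int
  assumes "finite H" "card H = 2 * h" "\<And>x y. x \<in> H \<Longrightarrow> y \<in> H \<Longrightarrow> int y \<le> int x + D"
    and "R \<le> (int h)\<^sup>2" "D \<ge> 0" "P \<subseteq> H" "card P = h"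
    and "R + int (\<Sum>P) - int (\<Sum>(H - P)) > D"
  shows "\<exists>P'. P' \<subseteq> H \<and> card P' = h \<and>
           \<bar>R + int (\<Sum>P') - int (\<Sum>(H - P'))\<bar> < \<bar>R + int (\<Sum>P) - int (\<Sum>(H - P))\<bar>"
proof -
  have fP: "finite P" using assms finite_subset by auto
  have N: "card (H - P) = h" using assms fP by (simp add: card_Diff_subset)
  have "\<exists>x\<in>H - P. \<exists>y\<in>P. x < y"
  proof (rule ccontr)
    assume no: "\<not> ?thesis"
    have "x < y" if "x \<in> P" "y \<in> H - P" for x y
      using no that by (metis DiffD2 linorder_neqE_nat)
    then have "int (\<Sum>(H - P)) - int (\<Sum>P) \<ge> (int h)\<^sup>2"
      using assms fP N by (intro sum_diff_ge_of_separated) auto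
    then show False using assms by linarith
  qed
  then obtain x y where xy: "x \<in> H - P" "y \<in> P" "x < y" by blast
  define P' where "P' = insert x (P - {y})"
  have "P' \<subseteq> H" using xy assms by (auto simp: P'_def)
  moreover have "card P' = h"
    using xy assms fP by (subst P'_def, subst card_insert_disjoint) (auto simp: card_Suc_Diff1 simp del: card_Diff_insert)
  moreover have "\<Sum>P = y + \<Sum>(P - {y})" using xy fP by (simp add: sum.remove)
  moreover have "\<Sum>P' = x + \<Sum>(P - {y})" using xy fP by (simp add: P'_def)
  moreover have "\<Sum>(H - P) = x + \<Sum>(H - P - {x})" using xy assms by (simp add: sum.remove)
  moreover have "H - P' = insert y (H - P - {x})" using xy assms by (auto simp: P'_def)
  then have "\<Sum>(H - P') = y + \<Sum>(H - P - {x})" using xy assms by simp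
  moreover have "int y \<le> int x + D" using assms xy by auto
  ultimately show ?thesis using xy assms by (intro exI[of _ P']) auto
qed

text \<open>A sum \<open>R\<close> is corrected by signing a set \<open>H\<close> of numbers that are close together but numerous. Among
  the signings with equally many signs of both kinds, one with the least absolute total cannot be
  improved by exchanging two signs.\<close>

lemma balanced_signing:
  fixes H :: "nat set" and R D :: int
  assumes "finite H" "card H = 2 * h" "\<And>x y. x \<in> H \<Longrightarrow> y \<in> H \<Longrightarrow> int y \<le> int x + D"
    and "\<bar>R\<bar> \<le> (int h)\<^sup>2" "D \<ge> 0"
  shows "\<exists>P\<subseteq>H. \<bar>R + int (\<Sum>P) - int (\<Sum>(H - P))\<bar> \<le> D"
proof -
  let ?s = "\<lambda>R P. R + int (\<Sum>P) - int (\<Sum>(H - P))"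
  obtain P0 where "P0 \<subseteq> H" "card P0 = h"
    using obtain_subset_with_card_n[of h H] assms by auto
  then obtain P where P: "P \<subseteq> H" "card P = h"
    and min: "\<And>P'. P' \<subseteq> H \<Longrightarrow> card P' = h \<Longrightarrow> nat \<bar>?s R P\<bar> \<le> nat \<bar>?s R P'\<bar>"
    using ex_has_least_nat[of "\<lambda>P. P \<subseteq> H \<and> card P = h" P0 "\<lambda>P. nat \<bar>?s R P\<bar>"] by blast
  have "\<not> ?s R P > D"
  proof
    assume "?s R P > D"
    then obtain P' where P': "P' \<subseteq> H" "card P' = h" "\<bar>?s R P'\<bar> < \<bar>?s R P\<bar>"
      using balanced_signing_step[OF assms(1-3) _ assms(5) P] assms(4) by (meson abs_le_D1)
    then show False using min[OF P'(1,2)] by linarith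
  qed
  moreover have "\<not> - ?s R P > D"
  proof
    assume *: "- ?s R P > D"
    \<comment> \<open>Exchanging the two sign classes and negating \<open>R\<close> negates the signed sum, which reduces this
      case to the previous one.\<close>
    have HP: "H - (H - P') = P'" if "P' \<subseteq> H" for P' using that by auto
    have neg: "?s (- R) (H - P') = - ?s R P'" if "P' \<subseteq> H" for P'
      using HP[OF that] by simp
    have card: "card (H - P') = h" if "P' \<subseteq> H" "card P' = h" for P'
      using that assms by (simp add: card_Diff_subset finite_subset)
    have "- R \<le> (int h)\<^sup>2" using assms(4) by linarith
    moreover have "?s (- R) (H - P) > D" using * neg[OF P(1)] by linarith
    ultimately obtain P' where P': "P' \<subseteq> H" "card P' = h" "\<bar>?s (- R) P'\<bar> < \<bar>?s (- R) (H - P)\<bar>"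
      using balanced_signing_step[OF assms(1-3) _ assms(5) Diff_subset card[OF P]] by blast
    have "?s (- R) P' = - ?s R (H - P')" using HP[OF P'(1)] by simp
    then have "\<bar>?s R (H - P')\<bar> < \<bar>?s R P\<bar>" using P'(3) neg[OF P(1)] by linarith
    moreover have "nat \<bar>?s R P\<bar> \<le> nat \<bar>?s R (H - P')\<bar>"
      using min[OF Diff_subset card[OF P'(1,2)]] .
    ultimately show False by linarith
  qed
  ultimately have "\<bar>?s R P\<bar> \<le> D" by linarith
  with P(1) show ?thesis by blast
qed

lemma greedy_signing:
  fixes A :: "nat set"
  assumes "finite A" "\<And>a. a \<in> A \<Longrightarrow> a \<le> m"
  shows "\<exists>Q\<subseteq>A. \<bar>int (\<Sum>Q) - int (\<Sum>(A - Q))\<bar> \<le> int m"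
  using assms
proof (induction A rule: finite_induct)
  case (insert a A)
  then obtain Q where Q: "Q \<subseteq> A" "\<bar>int (\<Sum>Q) - int (\<Sum>(A - Q))\<bar> \<le> int m" by auto
  have fQ: "finite Q" "a \<notin> Q" using Q insert finite_subset by auto
  have a: "int a \<le> int m" using insert by auto
  show ?case
  proof (cases "int (\<Sum>Q) \<le> int (\<Sum>(A - Q))")
    case True
    have "insert a A - insert a Q = A - Q" using insert by auto
    moreover have "\<Sum>(insert a Q) = a + \<Sum>Q" using fQ by simp
    ultimately have "\<bar>int (\<Sum>(insert a Q)) - int (\<Sum>(insert a A - insert a Q))\<bar> \<le> int m"
      using True Q(2) a by (simp only: of_nat_add)
    then show ?thesis using Q(1) by (meson insert_mono)
  next
    case False
    have "insert a A - Q = insert a (A - Q)" using fQ by auto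
    then have "\<Sum>(insert a A - Q) = a + \<Sum>(A - Q)" using insert by simp
    then have "\<bar>int (\<Sum>Q) - int (\<Sum>(insert a A - Q))\<bar> \<le> int m"
      using False Q(2) a by (simp only: of_nat_add)
    then show ?thesis using Q(1) by (meson subset_insertI2)
  qed
qed auto

text \<open>By the pigeonhole principle some window of width \<open>D\<close> contains \<open>2 * h\<close> elements of \<open>A\<close>. The other
  elements are signed greedily, with a sum of at most \<open>m\<close>, which the elements in the window can
  compensate up to \<open>D\<close>. A greedy signing alone would not suffice: its error may be
  comparable with the largest gap in \<open>A\<close>.\<close>

lemma small_signing:
  fixes A :: "nat set"
  assumes "A \<subseteq> {1..m}" "(m div D + 1) * (2 * h) \<le> card A" "m \<le> h\<^sup>2" "D > 0"
  shows "\<exists>Q\<subseteq>A. \<bar>int (\<Sum>Q) - int (\<Sum>(A - Q))\<bar> \<le> int D"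
proof -
  have fA: "finite A" using assms finite_subset by auto
  \<comment> \<open>The quotient by \<open>D\<close> names the window of width \<open>D\<close> that contains a number.\<close>
  have "\<exists>w. 2 * h \<le> card {a\<in>A. a div D = w}"
  proof (rule ccontr)
    assume no: "\<not> ?thesis"
    have "A = (\<Union>w\<le>m div D. {a\<in>A. a div D = w})"
      using assms(1) div_le_mono[of _ m D] by fastforce
    then have "card A \<le> (\<Sum>w\<le>m div D. card {a\<in>A. a div D = w})"
      using card_UN_le[of "{..m div D}" "\<lambda>w. {a\<in>A. a div D = w}"] by simp
    also have "\<dots> < (\<Sum>w\<le>m div D. 2 * h)"
      using no by (intro sum_strict_mono) (auto simp: not_le)
    finally show False using assms by simp
  qed
  then obtain w where "2 * h \<le> card {a\<in>A. a div D = w}" ..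
  then obtain H where H: "H \<subseteq> {a\<in>A. a div D = w}" "card H = 2 * h" "finite H"
    by (rule obtain_subset_with_card_n)
  have close: "int y \<le> int x + int D" if "x \<in> H" "y \<in> H" for x y
  proof -
    have "x div D = w" "y div D = w" using H(1) that by auto
    then have "D * w \<le> x" "y < D * w + D"
      using div_mult_mod_eq[of x D] div_mult_mod_eq[of y D] mod_less_divisor[OF assms(4), of y]
      by (auto simp: algebra_simps)
    then show ?thesis by linarith
  qed
  obtain Q where Q: "Q \<subseteq> A - H" "\<bar>int (\<Sum>Q) - int (\<Sum>(A - H - Q))\<bar> \<le> int m"
    using greedy_signing[of "A - H" m] fA assms(1) by (meson Diff_subset atLeastAtMost_iff finite_Diff subsetD)
  define R where "R = int (\<Sum>Q) - int (\<Sum>(A - H - Q))"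
  have "\<bar>R\<bar> \<le> (int h)\<^sup>2"
    using Q(2) assms(3) unfolding R_def by (metis of_nat_le_iff of_nat_power order_trans)
  then obtain P where P: "P \<subseteq> H" "\<bar>R + int (\<Sum>P) - int (\<Sum>(H - P))\<bar> \<le> int D"
    using balanced_signing[OF H(3,2) close] by auto
  have fin: "finite P" "finite Q"
    using finite_subset[OF P(1) H(3)] finite_subset[OF Q(1)] fA by auto
  have HA: "H \<subseteq> A" using H by auto
  have "\<Sum>(Q \<union> P) = \<Sum>Q + \<Sum>P"
    using P Q fin by (intro sum.union_disjoint) auto
  moreover have "A - (Q \<union> P) = (A - H - Q) \<union> (H - P)" using P Q HA by auto
  then have "\<Sum>(A - (Q \<union> P)) = \<Sum>(A - H - Q) + \<Sum>(H - P)"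
    using fA H(3) by (simp only:) (intro sum.union_disjoint, auto)
  ultimately have "\<bar>int (\<Sum>(Q \<union> P)) - int (\<Sum>(A - (Q \<union> P)))\<bar> \<le> int D"
    using P(2) by (simp only: of_nat_add R_def)
  moreover have "Q \<union> P \<subseteq> A" using P Q HA by auto
  ultimately show ?thesis by blast
qed

text \<open>The signed sum \<open>s\<close> of a good signing is spread evenly over the elements of \<open>A\<close>. As \<open>\<bar>s\<bar>\<close> is at most a
  quarter of \<open>card A\<close>, every element changes by at most \<open>1/4\<close>.\<close>

lemma balanced_lengths:
  fixes A :: "nat set"
  assumes "A \<subseteq> {1..m}" "(m div D + 1) * (2 * h) \<le> card A" "m \<le> h\<^sup>2" "D > 0" "4 * D \<le> card A"
  shows "\<exists>x :: nat \<Rightarrow> real. (\<Sum>a\<in>A. x a) = 0 \<and> (\<forall>a\<in>A. \<bar>\<bar>x a\<bar> - real a\<bar> \<le> 1 / 4)"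
proof -
  have fA: "finite A" using assms finite_subset by auto
  obtain Q where Q: "Q \<subseteq> A" "\<bar>int (\<Sum>Q) - int (\<Sum>(A - Q))\<bar> \<le> int D"
    using small_signing[OF assms(1-4)] by blast
  define s where "s = real (\<Sum>Q) - real (\<Sum>(A - Q))"
  define t where "t = s / real (card A)"
  define x where "x a = (if a \<in> Q then real a - t else - (real a + t))" for a
  have "s = of_int (int (\<Sum>Q) - int (\<Sum>(A - Q)))" by (simp add: s_def)
  then have "\<bar>s\<bar> = of_int \<bar>int (\<Sum>Q) - int (\<Sum>(A - Q))\<bar>" by (simp only: of_int_abs)
  also have "\<dots> \<le> of_int (int D)" using Q(2) by (simp only: of_int_le_iff)
  finally have "\<bar>s\<bar> \<le> real D" by simp
  also have "\<dots> \<le> real (card A) / 4" using assms(5) by linarith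
  finally have t: "\<bar>t\<bar> \<le> 1 / 4" using assms(4,5) by (simp add: t_def field_simps)
  have "(\<Sum>a\<in>A. x a) = (\<Sum>a\<in>Q. x a) + (\<Sum>a\<in>A - Q. x a)"
    using sum.subset_diff[OF Q(1) fA, of x] by simp
  also have "(\<Sum>a\<in>Q. x a) = real (\<Sum>Q) - real (card Q) * t"
    by (simp add: x_def sum_subtractf)
  also have "(\<Sum>a\<in>A - Q. x a) = - (real (\<Sum>(A - Q)) + real (card (A - Q)) * t)"
    by (simp add: x_def sum_negf sum.distrib sum_subtractf)
  also have "real (\<Sum>Q) - real (card Q) * t + - (real (\<Sum>(A - Q)) + real (card (A - Q)) * t)
      = s - real (card Q + card (A - Q)) * t"
    by (simp add: s_def algebra_simps)
  also have "card Q + card (A - Q) = card A"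
    using Q(1) fA by (simp add: card_Diff_subset card_mono finite_subset)
  also have "s - real (card A) * t = 0" using assms(4,5) by (simp add: t_def)
  finally have "(\<Sum>a\<in>A. x a) = 0" .
  moreover have "\<bar>\<bar>x a\<bar> - real a\<bar> \<le> 1 / 4" if "a \<in> A" for a
  proof -
    have "real a \<ge> 1" using that assms(1) by auto
    then show ?thesis using t by (auto simp: x_def)
  qed
  ultimately show ?thesis by blast
qed

section \<open>Realizing orders\<close>

lemma total_edge_order_rank:
  assumes "total_edge_order E r" "finite E"
  obtains \<rho> :: "'e \<Rightarrow> nat" where
    "inj_on \<rho> E" "\<rho> ` E \<subseteq> {1..card E}"
    "\<And>e f. e \<in> E \<Longrightarrow> f \<in> E \<Longrightarrow> (e, f) \<in> r \<longleftrightarrow> \<rho> e < \<rho> f"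
proof
  \<comment> \<open>Inserting \<open>e\<close> itself makes the ranks start at 1 rather than 0.\<close>
  define \<rho> where "\<rho> e = card (insert e {g\<in>E. (g, e) \<in> r})" for e
  have r: "trans r" "irrefl r" "total_on E r"
    using assms unfolding total_edge_order_def strict_linear_order_on_def by auto
  have less: "\<rho> e < \<rho> f" if "(e, f) \<in> r" "e \<in> E" "f \<in> E" for e f
    unfolding \<rho>_def
  proof (rule psubset_card_mono)
    have "insert e {g\<in>E. (g, e) \<in> r} \<subseteq> {g\<in>E. (g, f) \<in> r}"
      using that r(1) by (auto dest: transD)
    moreover have "(f, f) \<notin> r" using r(2) by (auto simp: irrefl_def)
    ultimately show "insert e {g\<in>E. (g, e) \<in> r} \<subset> insert f {g\<in>E. (g, f) \<in> r}" by blast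
  qed (use assms in auto)
  show iff: "(e, f) \<in> r \<longleftrightarrow> \<rho> e < \<rho> f" if "e \<in> E" "f \<in> E" for e f
  proof (cases "e = f")
    case True
    then show ?thesis using r(2) by (auto simp: irrefl_def)
  next
    case False
    then show ?thesis using less that r(3) unfolding total_on_def by (metis less_asym)
  qed
  show "inj_on \<rho> E"
    by (rule inj_onI) (metis iff r(3) total_on_def less_irrefl)
  show "\<rho> ` E \<subseteq> {1..card E}"
  proof
    fix y assume "y \<in> \<rho> ` E"
    then obtain e where e: "e \<in> E" "y = \<rho> e" by auto
    have "\<rho> e \<le> card E" unfolding \<rho>_def using e assms(2) by (intro card_mono) auto
    moreover have "\<rho> e \<ge> 1" unfolding \<rho>_def using assms(2) by (simp add: Suc_le_eq card_gt_0_iff)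
    ultimately show "y \<in> {1..card E}" using e by simp
  qed
qed

text \<open>A realization need not be checked for injectivity: the comparisons of the edge lengths are strict
  inequalities, so they survive a small perturbation of the vertices.\<close>

lemma realizable_if_strict:
  fixes p :: "nat \<Rightarrow> real"
  assumes "simple_graph V E"
    and p: "\<And>u v x y. \<lbrakk>{u, v} \<in> E; {x, y} \<in> E; {u, v} \<noteq> {x, y}\<rbrakk> \<Longrightarrow>
            \<bar>p u - p v\<bar> \<noteq> \<bar>p x - p y\<bar> \<and>
            (({u, v}, {x, y}) \<in> r \<longleftrightarrow> \<bar>p u - p v\<bar> < \<bar>p x - p y\<bar>)"
  shows "realizable V E r"
proof -
  have fV: "finite V" and EV: "E \<subseteq> Pow V" using assms unfolding simple_graph_def by auto
  \<comment> \<open>Moving the vertices with pairwise distinct speeds separates those that coincide.\<close>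
  define q where "q t v = p v + t * real v" for t v
  have lim: "((\<lambda>t. \<bar>q t u - q t v\<bar>) \<longlongrightarrow> \<bar>p u - p v\<bar>) (at_right 0)" for u v
    unfolding q_def by (rule tendsto_eq_intros refl | simp)+
  have less: "\<forall>\<^sub>F t in at_right 0. \<bar>q t u - q t v\<bar> < \<bar>q t x - q t y\<bar>"
    if "\<bar>p u - p v\<bar> < \<bar>p x - p y\<bar>" for u v x y
    using order_tendstoD(2)[OF tendsto_diff[OF lim lim], of u v x y 0] that by simp
  have "\<forall>\<^sub>F t in at_right 0. q t u \<noteq> q t v" if "u \<noteq> v" for u v
  proof (cases "p u = p v")
    case True
    have "\<forall>\<^sub>F t in at_right (0::real). t > 0" by (rule eventually_at_right_less)
    then show ?thesis by eventually_elim (use True that in \<open>simp add: q_def\<close>)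
  next
    case False
    have "\<forall>\<^sub>F t in at_right 0. \<bar>q t u - q t v\<bar> > 0"
      using order_tendstoD(1)[OF lim, of 0 u v] False by simp
    then show ?thesis by eventually_elim auto
  qed
  then have "\<forall>\<^sub>F t in at_right 0. \<forall>u\<in>V. \<forall>v\<in>V. u \<noteq> v \<longrightarrow> q t u \<noteq> q t v"
    using fV by (intro eventually_ball_finite ballI) (auto intro: eventually_mono)
  moreover have "\<forall>\<^sub>F t in at_right 0. \<bar>p u - p v\<bar> < \<bar>p x - p y\<bar> \<longrightarrow> \<bar>q t u - q t v\<bar> < \<bar>q t x - q t y\<bar>"
    for u v x y using less by (cases "\<bar>p u - p v\<bar> < \<bar>p x - p y\<bar>") auto
  then have "\<forall>\<^sub>F t in at_right 0. \<forall>u\<in>V. \<forall>v\<in>V. \<forall>x\<in>V. \<forall>y\<in>V.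
      \<bar>p u - p v\<bar> < \<bar>p x - p y\<bar> \<longrightarrow> \<bar>q t u - q t v\<bar> < \<bar>q t x - q t y\<bar>"
    using fV by (intro eventually_ball_finite ballI) auto
  ultimately have "\<forall>\<^sub>F t in at_right 0. (\<forall>u\<in>V. \<forall>v\<in>V. u \<noteq> v \<longrightarrow> q t u \<noteq> q t v) \<and>
      (\<forall>u\<in>V. \<forall>v\<in>V. \<forall>x\<in>V. \<forall>y\<in>V.
      \<bar>p u - p v\<bar> < \<bar>p x - p y\<bar> \<longrightarrow> \<bar>q t u - q t v\<bar> < \<bar>q t x - q t y\<bar>)"
    by (rule eventually_conj)
  from eventually_happens'[OF trivial_limit_at_right_real this] obtain t where
    t: "\<forall>u\<in>V. \<forall>v\<in>V. u \<noteq> v \<longrightarrow> q t u \<noteq> q t v"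
      "\<forall>u\<in>V. \<forall>v\<in>V. \<forall>x\<in>V. \<forall>y\<in>V.
        \<bar>p u - p v\<bar> < \<bar>p x - p y\<bar> \<longrightarrow> \<bar>q t u - q t v\<bar> < \<bar>q t x - q t y\<bar>"
    by (elim exE conjE)
  have "inj_on (q t) V" using t(1) by (auto simp: inj_on_def)
  moreover have "\<bar>q t u - q t v\<bar> \<noteq> \<bar>q t x - q t y\<bar> \<and>
            (({u, v}, {x, y}) \<in> r \<longleftrightarrow> \<bar>q t u - q t v\<bar> < \<bar>q t x - q t y\<bar>)"
    if e: "{u, v} \<in> E" "{x, y} \<in> E" "{u, v} \<noteq> {x, y}" for u v x y
  proof -
    have V: "u \<in> V" "v \<in> V" "x \<in> V" "y \<in> V" using EV e by auto
    show ?thesis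
      using p[OF e] t(2)[rule_format, OF V] t(2)[rule_format, OF V(3,4,1,2)] by linarith
  qed
  ultimately show ?thesis unfolding realizable_def by blast
qed

section \<open>Cycles through a common vertex\<close>

text \<open>The cycles through \<open>0\<close> are the residue classes modulo \<open>k\<close> of the vertices \<open>1, \<dots>, n - 1\<close>, traversed
  in increasing order. The edge with index \<open>v\<close> leads from \<open>v - k\<close> to \<open>v\<close>, where the truncated subtraction
  makes the first \<open>k\<close> edges start at \<open>0\<close>; the indices \<open>n, \<dots>, n + k - 1\<close> belong to the closing edges, which
  return to \<open>0\<close>. So the edges of a cycle are a residue class of indices too.\<close>

definition bouquet_edge :: "nat \<Rightarrow> nat \<Rightarrow> nat \<Rightarrow> nat set" where
  "bouquet_edge n k v = {v - k, if v < n then v else 0}"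

lemma inj_on_bouquet_edge:
  assumes "1 \<le> k" "2 * k < n"
  shows "inj_on (bouquet_edge n k) {1..<n + k}"
proof (rule inj_onI)
  fix u v assume "u \<in> {1..<n + k}" "v \<in> {1..<n + k}" "bouquet_edge n k u = bouquet_edge n k v"
  then show "u = v" using assms
    unfolding bouquet_edge_def by (auto simp: doubleton_eq_iff split: if_splits)
qed

lemma simple_graph_bouquet:
  assumes "1 \<le> k" "2 * k < n"
  shows "simple_graph {..<n} (bouquet_edge n k ` {1..<n + k})"
  unfolding simple_graph_def
proof (intro conjI ballI)
  fix e assume "e \<in> bouquet_edge n k ` {1..<n + k}"
  then obtain v where "v \<in> {1..<n + k}" "e = bouquet_edge n k v" by auto
  then show "\<exists>u v. u \<in> {..<n} \<and> v \<in> {..<n} \<and> u \<noteq> v \<and> e = {u, v}"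
    using assms unfolding bouquet_edge_def
    by (intro exI[of _ "v - k"] exI[of _ "if v < n then v else 0"]) auto
qed simp

text \<open>Signed lengths that add up to zero around every cycle are the differences of a potential, which
  is the signed length of the way from \<open>0\<close>.\<close>

lemma bouquet_potential:
  fixes x :: "nat \<Rightarrow> real"
  assumes "1 \<le> k" "2 * k < n"
    and closed: "\<And>j. j < k \<Longrightarrow> (\<Sum>u | u \<in> {1..<n + k} \<and> u mod k = j. x u) = 0"
  obtains p :: "nat \<Rightarrow> real" where
    "\<And>v. v \<in> {1..<n + k} \<Longrightarrow> p (if v < n then v else 0) - p (v - k) = x v"
proof
  \<comment> \<open>The signed length of the walk from \<open>0\<close> along the cycle of \<open>v\<close>, up to the edge with index \<open>v\<close>.\<close>
  define S where "S v = (\<Sum>u | u \<in> {1..v} \<and> u mod k = v mod k. x u)" for v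
  have step: "S v = S (v - k) + x v" if "v \<ge> 1" for v
  proof -
    have "{u. u \<in> {1..v} \<and> u mod k = v mod k} =
        insert v {u. u \<in> {1..v - k} \<and> u mod k = (v - k) mod k}" (is "?A = insert v ?B")
    proof (intro equalityI subsetI)
      fix u assume u: "u \<in> ?A"
      show "u \<in> insert v ?B"
      proof (cases "u = v")
        case False
        then have "u < v" using u by auto
        moreover have "k dvd v - u" using u mod_eq_dvd_iff_nat[of u v k] by auto
        ultimately have "k \<le> v - u" by (auto intro: dvd_imp_le)
        then have "u \<le> v - k" "k \<le> v" using u by auto
        then show ?thesis using u by (simp add: le_mod_geq)
      qed simp
    next
      fix u assume u: "u \<in> insert v ?B"
      show "u \<in> ?A"
      proof (cases "u = v")
        case False
        then have "u \<in> {1..v - k}" "u mod k = (v - k) mod k" using u by auto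
        then show ?thesis by (auto simp: le_mod_geq)
      qed (use that in auto)
    qed
    moreover have "v \<notin> ?B" using assms(1) that by auto
    ultimately show ?thesis unfolding S_def by simp
  qed
  have S0: "S 0 = 0" by (simp add: S_def)
  fix v assume v: "v \<in> {1..<n + k}"
  show "S (if v < n then v else 0) - S (v - k) = x v"
  proof (cases "v < n")
    case True
    then show ?thesis using step v by simp
  next
    case False
    have "{u. u \<in> {1..v} \<and> u mod k = v mod k} = {u. u \<in> {1..<n + k} \<and> u mod k = v mod k}"
    proof (intro equalityI subsetI)
      fix u assume u: "u \<in> {u. u \<in> {1..<n + k} \<and> u mod k = v mod k}"
      show "u \<in> {u. u \<in> {1..v} \<and> u mod k = v mod k}"
      proof (rule ccontr)
        assume "\<not> ?thesis"
        then have "v < u" using u by auto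
        moreover have "k dvd u - v" using u \<open>v < u\<close> mod_eq_dvd_iff_nat[of v u k] by auto
        ultimately have "k \<le> u - v" by (auto intro: dvd_imp_le)
        then show False using u False \<open>v < u\<close> by auto
      qed
    qed (use v in auto)
    then have "S v = 0" unfolding S_def using closed[of "v mod k"] assms(1) by simp
    then show ?thesis using step[of v] S0 False v by simp
  qed
qed

lemma card_residue_class_ge:
  assumes "j < k"
  shows "m div k \<le> card {u \<in> {1..m}. u mod k = j}"
proof -
  \<comment> \<open>The least positive element of the residue class.\<close>
  define c where "c = (if j = 0 then k else j)"
  have c: "1 \<le> c" "c \<le> k" "c mod k = j" using assms by (auto simp: c_def)
  have "card ((\<lambda>t. t * k + c) ` {..<m div k}) \<le> card {u \<in> {1..m}. u mod k = j}"
  proof (rule card_mono)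
    show "(\<lambda>t. t * k + c) ` {..<m div k} \<subseteq> {u \<in> {1..m}. u mod k = j}"
    proof clarify
      fix t assume "t < m div k"
      then have "Suc t * k \<le> m div k * k" by (intro mult_right_mono) auto
      also have "\<dots> \<le> m" by simp
      finally show "t * k + c \<in> {1..m} \<and> (t * k + c) mod k = j"
        using c by auto
    qed
  qed simp
  moreover have "inj_on (\<lambda>t. t * k + c) {..<m div k}" using assms by (auto simp: inj_on_def)
  ultimately show ?thesis by (simp add: card_image)
qed

text \<open>The numerical assumptions are those of \<open>balanced_lengths\<close> for every cycle, since each of them has at
  least \<open>m div k\<close> edges. Lengths within \<open>1/4\<close> of distinct integers are ordered like these integers.\<close>

lemma all_orders_realizable_bouquet:
  assumes "1 \<le> k" "2 * k < n" and m: "m = n + k - 1"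
    and "(m div D + 1) * (2 * h) \<le> m div k" "m \<le> h\<^sup>2" "D > 0" "4 * D \<le> m div k"
  shows "all_orders_realizable {..<n} (bouquet_edge n k ` {1..<n + k})"
  unfolding all_orders_realizable_def
proof (intro allI impI)
  let ?I = "{1..<n + k}" and ?e = "bouquet_edge n k"
  fix r assume r: "total_edge_order (?e ` ?I) r"
  note inj = inj_on_bouquet_edge[OF assms(1,2)]
  have cardE: "card (?e ` ?I) = m" using card_image[OF inj] m by simp
  obtain \<rho> where \<rho>: "inj_on \<rho> (?e ` ?I)" "\<rho> ` ?e ` ?I \<subseteq> {1..m}"
    "\<And>e f. e \<in> ?e ` ?I \<Longrightarrow> f \<in> ?e ` ?I \<Longrightarrow> (e, f) \<in> r \<longleftrightarrow> \<rho> e < \<rho> f"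
    using total_edge_order_rank[OF r] unfolding cardE by auto
  define rk where "rk u = \<rho> (?e u)" for u
  have rk: "inj_on rk ?I" "rk ` ?I \<subseteq> {1..m}"
    using comp_inj_on[OF inj \<rho>(1)] \<rho>(2) unfolding rk_def comp_def by (simp_all add: image_image)
  \<comment> \<open>The residue class \<open>C j\<close> consists of the edges of one cycle.\<close>
  define C where "C j = {u. u \<in> ?I \<and> u mod k = j}" for j
  have I: "?I = {1..m}" using m assms by auto
  have rkC: "inj_on rk (C j)" for j
    using rk(1) by (rule inj_on_subset) (auto simp: C_def)
  have "\<exists>x. (\<Sum>a\<in>rk ` C j. x a) = 0 \<and> (\<forall>a\<in>rk ` C j. \<bar>\<bar>x a\<bar> - real a\<bar> \<le> 1 / 4)" if "j < k" for j
  proof -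
    have "card (rk ` C j) = card (C j)" using rkC by (rule card_image)
    moreover have "m div k \<le> card (C j)"
      using card_residue_class_ge[OF that, of m] unfolding C_def I by simp
    ultimately have "m div k \<le> card (rk ` C j)" by simp
    moreover have "rk ` C j \<subseteq> {1..m}" using rk(2) by (auto simp: C_def)
    ultimately show ?thesis
      using assms by (intro balanced_lengths[of _ m D h]) auto
  qed
  then obtain X where X: "\<And>j. j < k \<Longrightarrow> (\<Sum>a\<in>rk ` C j. X j a) = 0"
    "\<And>j a. j < k \<Longrightarrow> a \<in> rk ` C j \<Longrightarrow> \<bar>\<bar>X j a\<bar> - real a\<bar> \<le> 1 / 4"
    by metis
  define x where "x u = X (u mod k) (rk u)" for u
  have x: "\<bar>\<bar>x u\<bar> - real (rk u)\<bar> \<le> 1 / 4" if "u \<in> ?I" for u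
    using X(2)[of "u mod k" "rk u"] that assms(1) by (auto simp: x_def C_def)
  have "(\<Sum>u | u \<in> ?I \<and> u mod k = j. x u) = 0" if "j < k" for j
  proof -
    have "(\<Sum>u\<in>C j. x u) = (\<Sum>u\<in>C j. X j (rk u))"
      by (intro sum.cong) (auto simp: x_def C_def)
    also have "\<dots> = (\<Sum>a\<in>rk ` C j. X j a)"
      by (simp add: sum.reindex[OF rkC])
    finally show ?thesis using X(1)[OF that] by (simp add: C_def)
  qed
  then obtain p where p: "\<And>v. v \<in> ?I \<Longrightarrow> p (if v < n then v else 0) - p (v - k) = x v"
    using bouquet_potential[OF assms(1,2)] by blast
  have len: "\<bar>p a - p b\<bar> = \<bar>x v\<bar>" if "v \<in> ?I" "{a, b} = ?e v" for a b v
    using p[OF that(1)] that(2) unfolding bouquet_edge_def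
    by (auto simp: doubleton_eq_iff)
  show "realizable {..<n} (?e ` ?I) r"
  proof (rule realizable_if_strict[OF simple_graph_bouquet[OF assms(1,2)]])
    fix a b c d assume e: "{a, b} \<in> ?e ` ?I" "{c, d} \<in> ?e ` ?I" "{a, b} \<noteq> {c, d}"
    obtain u v where uv: "u \<in> ?I" "v \<in> ?I" "{a, b} = ?e u" "{c, d} = ?e v"
      using imageE[OF e(1)] imageE[OF e(2)] by metis
    have "rk u \<noteq> rk v" using uv e(3) inj_onD[OF rk(1)] by metis
    moreover have "({a, b}, {c, d}) \<in> r \<longleftrightarrow> rk u < rk v"
      using \<rho>(3)[OF e(1,2)] uv by (simp add: rk_def)
    moreover have "\<bar>p a - p b\<bar> = \<bar>x u\<bar>" "\<bar>p c - p d\<bar> = \<bar>x v\<bar>" using len uv by auto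
    ultimately show "\<bar>p a - p b\<bar> \<noteq> \<bar>p c - p d\<bar> \<and> (({a, b}, {c, d}) \<in> r \<longleftrightarrow> \<bar>p a - p b\<bar> < \<bar>p c - p d\<bar>)"
      using x[OF uv(1)] x[OF uv(2)] by linarith
  qed
qed

section \<open>The asymptotic bounds\<close>

text \<open>The fourth power comes from the assumption \<open>m \<le> h\<^sup>2\<close>: a cycle has about \<open>n / k\<close> edges, there are of
  order \<open>k\<close> windows of width a quarter of this, so a window provides \<open>h\<close> of order \<open>n / k\<^sup>2\<close>.\<close>

lemma ex_R_ge:
  assumes "1 \<le> k" "200 * k ^ 4 \<le> n"
  shows "n + k - 1 \<le> ex_R n"
proof -
  define m where "m = n + k - 1"
  define q where "q = m div k"
  define D where "D = q div 4"
  \<comment> \<open>By the choice of \<open>D\<close> there are at most \<open>6 * k\<close> windows, so \<open>2 * h\<close> of the at least \<open>q\<close> ranks of a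
    cycle lie in one of them.\<close>
  define h where "h = q div (12 * k)"
  have pow: "k \<le> k ^ 2" "k ^ 2 \<le> k ^ 3" "k ^ 3 \<le> k ^ 4"
    using assms(1) by (auto intro: power_increasing[where n = 1, simplified] power_increasing)
  have "168 * k ^ 3 * k = 168 * k ^ 4" by (simp add: power3_eq_cube power4_eq_xxxx)
  then have "168 * k ^ 3 * k \<le> m" using assms by (simp add: m_def)
  then have q: "168 * k ^ 3 \<le> q"
    unfolding q_def using assms(1) by (subst less_eq_div_iff_mult_less_eq) auto
  then have "14 * k ^ 2 * (12 * k) \<le> q" by (simp add: power3_eq_cube power2_eq_square)
  then have h: "14 * k ^ 2 \<le> h"
    unfolding h_def using assms(1) by (subst less_eq_div_iff_mult_less_eq) auto
  have mq: "m < (q + 1) * k"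
    unfolding q_def using assms(1) dividend_less_div_times[of k m] by (simp add: algebra_simps)
  have "q + 1 \<le> (h + 1) * (12 * k)"
    unfolding h_def using assms(1) dividend_less_div_times[of "12 * k" q] by (simp add: algebra_simps)
  then have "(q + 1) * k \<le> (h + 1) * (12 * k) * k" by (rule mult_right_mono) simp
  then have "m \<le> 12 * k ^ 2 * h + 12 * k ^ 2" using mq by (simp add: algebra_simps power2_eq_square)
  also have "\<dots> \<le> 14 * k ^ 2 * h"
  proof -
    have "6 \<le> h" using h assms(1) pow by linarith
    then have "2 * k ^ 2 * 6 \<le> 2 * k ^ 2 * h" by (intro mult_left_mono) auto
    then show ?thesis by (simp add: algebra_simps)
  qed
  also have "\<dots> \<le> h * h" using h by (intro mult_right_mono) auto
  finally have mh: "m \<le> h\<^sup>2" by (simp add: power2_eq_square)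
  have D: "4 \<le> D" "q \<le> 4 * D + 3" "4 * D \<le> q" using q pow assms(1) unfolding D_def by auto
  have "m < (q + 1) * k" by (rule mq)
  also have "\<dots> \<le> (5 * D) * k" using D by (intro mult_right_mono) auto
  finally have "m div D < 5 * k" using D by (simp add: div_less_iff_less_mult algebra_simps)
  then have "m div D + 1 \<le> 6 * k" by linarith
  then have "(m div D + 1) * (2 * h) \<le> 6 * k * (2 * h)" by (rule mult_right_mono) simp
  also have "\<dots> = h * (12 * k)" by simp
  also have "\<dots> \<le> q" unfolding h_def by simp
  finally have win: "(m div D + 1) * (2 * h) \<le> q" .
  have kn: "2 * k < n" using assms pow by linarith
  have "all_orders_realizable {..<n} (bouquet_edge n k ` {1..<n + k})"
    using all_orders_realizable_bouquet[OF assms(1) kn m_def] win mh D unfolding q_def by simp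
  moreover have "card (bouquet_edge n k ` {1..<n + k}) = n + k - 1"
    using card_image[OF inj_on_bouquet_edge[OF assms(1) kn]] by simp
  ultimately have "n + k - 1 \<in> ex_candidates n"
    unfolding ex_candidates_def using simple_graph_bouquet[OF assms(1) kn]
    by (metis (mono_tags, lifting) card_lessThan mem_Collect_eq)
  then show ?thesis unfolding ex_R_def using finite_ex_candidates by (intro Max_ge)
qed

theorem theorem8:
  shows "\<exists>f g :: nat \<Rightarrow> real.
     f \<in> O(\<lambda>n. ln (ln (real n))) \<and>
     g \<in> O(\<lambda>n. real n / (ln (real n))\<^sup>2) \<and>
     (\<forall>\<^sub>F n in sequentially.
        real n + ln (real n) / ln 3 - f n \<le> real (ex_R n) \<and>
        real (ex_R n) \<le> real n + 2 * real n / ln (real n) + g n)"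
proof (intro exI conjI)
  let ?g = "\<lambda>n::nat. 2 * real n / (ln (real n) - 2) - 2 * real n / ln (real n)"
  show "(\<lambda>_. 0) \<in> O(\<lambda>n. ln (ln (real n)))" by simp
  show "?g \<in> O(\<lambda>n. real n / (ln (real n))\<^sup>2)" by real_asymp
  have "\<forall>\<^sub>F n::nat in sequentially. 200 * (ln (real n) + 2) ^ 4 \<le> real n" by real_asymp
  moreover have "\<forall>\<^sub>F n::nat in sequentially. ln (real n) > 2" by real_asymp
  ultimately show "\<forall>\<^sub>F n in sequentially.
        real n + ln (real n) / ln 3 - 0 \<le> real (ex_R n) \<and>
        real (ex_R n) \<le> real n + 2 * real n / ln (real n) + ?g n"
  proof eventually_elim
    case (elim n)
    \<comment> \<open>The summand 1 pays for the loss of one edge in \<open>n + k - 1\<close>.\<close>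
    define k where "k = nat \<lceil>ln (real n)\<rceil> + 1"
    have k: "real k \<le> ln (real n) + 2" "ln (real n) + 1 \<le> real k"
      using elim(2) unfolding k_def by linarith+
    have "200 * real k ^ 4 \<le> 200 * (ln (real n) + 2) ^ 4"
      using k(1) by (intro mult_left_mono power_mono) auto
    also have "\<dots> \<le> real n" by (rule elim(1))
    finally have "real (200 * k ^ 4) \<le> real n" by simp
    then have "200 * k ^ 4 \<le> n" by (simp only: of_nat_le_iff)
    then have "n + k - 1 \<le> ex_R n" by (intro ex_R_ge) (simp_all add: k_def)
    then have "real (n + k) \<le> real (ex_R n) + 1" by linarith
    moreover have "ln (real n) / ln 3 \<le> ln (real n)"
    proof -
      have "(1::real) \<le> ln 3" using exp_le ln_ge_iff[of 3 1] by simp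
      then show ?thesis using elim(2) by (simp add: field_simps mult_le_cancel_left1)
    qed
    ultimately show ?case using k(2) ex_R_le[OF elim(2)] by simp
  qed
qed

end
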